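(* Let $G$ be a module over a principal ideal domain $R$ which has partial decomposition bases $\mathcal{C}$ and $\mathcal{C}'$. Let $X \in \mathcal{C}$ and $Y \in \mathcal{C}'$. Then there are decomposition sets $X'$ and $Y'$ such that $X \subseteq X'$, $Y \subseteq Y'$, $X'$ is the union of an ascending chain of elements of $\mathcal{C}$, $Y'$ is the union of an ascending chain of elements of $\mathcal{C}'$, and $\langle X'\rangle^0 = \langle Y'\rangle^0$.
   Context: For a prime $p$ of $R$, define $p^0G=G$, $p^{\beta+1}G=p(p^\beta G)$, $p^\alpha G=\bigcap_{\beta<\alpha}p^\beta G$ for limit $\alpha$; the $p$-height $|x|_p$ is the ordinal $\alpha$ with $x\in p^\alpha G\setminus p^{\alpha+1}G$, or $\infty$ if none exists. A subset $X\subseteq G$ is a decomposition set if $X$ is an $R$-linearly independent set of elements of infinite order and for all $x_1,\dots,x_n\in X$, $a_1,\dots,a_n\in R$ and every prime $p$ of $R$, $|a_1x_1+\cdots+a_nx_n|_p=\min_{1\le i\le n}|a_ix_i|_p$. For a submodule $K$ of $G$, $K^0=\{x\in G: ax\in K \text{ for some } a\in R\setminus\{0\}\}$; $\langle X\rangle$ denotes the submodule generated by $X$. A partial decomposition basis for $G$ is a collection $\mathcal{C}$ such that (i) $\mathcal{C}$ is a nonempty collection of finite subsets of $G$; (ii) each $X\in\mathcal{C}$ is a decomposition set; (iii) if $X\in\mathcal{C}$ and $x\in G$, there is $Y\in\mathcal{C}$ with $X\subseteq Y$ and $x\in\langle Y\rangle^0$. *)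

theory Defs
  imports
    HOL.Modules
    "HOL-Computational_Algebra.Factorial_Ring"
    "HOL-Library.Extended"
begin

section \<open>Ordinals large enough to measure heights\<close>

text \<open>
  HOL has no type of all ordinals. The elements of \<open>'g ordinal\<close> are the ordinals below the
  successor cardinal of \<open>max |'g| \<aleph>\<^sub>0\<close>, which is a limit ordinal. This loses nothing: every
  descending filtration of subsets of \<open>'g\<close> becomes stationary below that ordinal (see
  \<open>p_power_stationary\<close> below).
\<close>

typedef 'g ordinal = "Field (cardSuc (card_of (UNIV :: ('g + nat) set)))"
  using Field_cardSuc_not_empty card_of_Card_order by blast

lemma cardSuc_wo_rel: "wo_rel (cardSuc (card_of (UNIV :: ('g + nat) set)))"
  using cardSuc_Card_order[OF card_of_Card_order]
  unfolding wo_rel_def card_order_on_def by blast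

instantiation ordinal :: (type) wellorder
begin

definition less_eq_ordinal :: "'a ordinal \<Rightarrow> 'a ordinal \<Rightarrow> bool" where
  "\<alpha> \<le> \<beta> \<longleftrightarrow>
     (Rep_ordinal \<alpha>, Rep_ordinal \<beta>) \<in> cardSuc (card_of (UNIV :: ('a + nat) set))"

definition less_ordinal :: "'a ordinal \<Rightarrow> 'a ordinal \<Rightarrow> bool" where
  "(\<alpha> :: 'a ordinal) < \<beta> \<longleftrightarrow> \<alpha> \<le> \<beta> \<and> \<alpha> \<noteq> \<beta>"

instance
proof
  let ?r = "cardSuc (card_of (UNIV :: ('a + nat) set))"
  note wo = cardSuc_wo_rel[where 'g = 'a]
  show antisym: "\<alpha> = \<beta>" if "\<alpha> \<le> \<beta>" "\<beta> \<le> \<alpha>" for \<alpha> \<beta> :: "'a ordinal"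
    using that wo_rel.ANTISYM[OF wo] unfolding less_eq_ordinal_def antisym_def
    by (metis Rep_ordinal_inject)
  show "(\<alpha> < \<beta>) = (\<alpha> \<le> \<beta> \<and> \<not> \<beta> \<le> \<alpha>)" for \<alpha> \<beta> :: "'a ordinal"
    using antisym unfolding less_ordinal_def by blast
  show "\<alpha> \<le> \<alpha>" for \<alpha> :: "'a ordinal"
    using wo_rel.REFL[OF wo] Rep_ordinal[of \<alpha>]
    unfolding less_eq_ordinal_def refl_on_def by blast
  show "\<alpha> \<le> \<gamma>" if "\<alpha> \<le> \<beta>" "\<beta> \<le> \<gamma>" for \<alpha> \<beta> \<gamma> :: "'a ordinal"
    using that wo_rel.TRANS[OF wo] unfolding less_eq_ordinal_def trans_def by blast
  show "\<alpha> \<le> \<beta> \<or> \<beta> \<le> \<alpha>" for \<alpha> \<beta> :: "'a ordinal"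
    using wo_rel.TOTALS[OF wo] Rep_ordinal[of \<alpha>] Rep_ordinal[of \<beta>]
    unfolding less_eq_ordinal_def by blast
  show "P \<alpha>" if "\<And>\<alpha>. (\<And>\<beta>. \<beta> < \<alpha> \<Longrightarrow> P \<beta>) \<Longrightarrow> P \<alpha>" for P and \<alpha> :: "'a ordinal"
  proof -
    have "wf (inv_image (?r - Id) (Rep_ordinal :: 'a ordinal \<Rightarrow> _))"
      using wo_rel.WF[OF wo] by (rule wf_inv_image)
    then show ?thesis
    proof (induction \<alpha> rule: wf_induct_rule)
      case (less \<alpha>)
      then show ?case
        by (rule that) (simp add: less_ordinal_def less_eq_ordinal_def Rep_ordinal_inject)
    qed
  qed
qed

end

instance ordinal :: (type) no_top
proof
  fix \<alpha> :: "'a ordinal"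
  let ?r = "cardSuc (card_of (UNIV :: ('a + nat) set))"
  have "infinite (Field ?r)"
    by (simp add: cardSuc_finite[OF card_of_Card_order] Field_card_of)
  then obtain b where "b \<in> Field ?r" "Rep_ordinal \<alpha> \<noteq> b" "(Rep_ordinal \<alpha>, b) \<in> ?r"
    using infinite_Card_order_limit[OF cardSuc_Card_order[OF card_of_Card_order]] Rep_ordinal
    by metis
  then show "\<exists>\<beta>. \<alpha> < \<beta>"
    by (intro exI[of _ "Abs_ordinal b"])
       (metis Abs_ordinal_inverse less_eq_ordinal_def less_ordinal_def)
qed

instantiation ordinal :: (type) zero
begin
definition zero_ordinal :: "'a ordinal" where "(0 :: 'a ordinal) = (LEAST \<alpha>. True)"
instance ..
end

lemma ordinal_zero_le [simp]: "(0 :: 'g ordinal) \<le> \<alpha>"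
  unfolding zero_ordinal_def by (rule Least_le) simp

definition osucc :: "'g ordinal \<Rightarrow> 'g ordinal" where
  "osucc \<alpha> = (LEAST \<beta>. \<alpha> < \<beta>)"

lemma less_osucc [simp]: "\<alpha> < osucc \<alpha>"
  unfolding osucc_def using gt_ex by (rule LeastI_ex)

lemma osucc_le: "\<alpha> < \<beta> \<Longrightarrow> osucc \<alpha> \<le> \<beta>"
  unfolding osucc_def by (rule Least_le)

lemma osucc_inject [simp]: "osucc \<alpha> = osucc \<beta> \<longleftrightarrow> \<alpha> = \<beta>"
  by (metis less_osucc linorder_neqE osucc_le leD)

lemma osucc_not_zero [simp]: "osucc \<alpha> \<noteq> 0"
  by (metis leD less_osucc ordinal_zero_le)

lemma THE_osucc [simp]: "(THE \<beta>. osucc \<alpha> = osucc \<beta>) = \<alpha>"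
  by auto


section \<open>Principal ideal domains\<close>

class principal_ideal_domain = idom +
  assumes ideal_principal:
    "0 \<in> I \<Longrightarrow> (\<And>x y. x \<in> I \<Longrightarrow> y \<in> I \<Longrightarrow> x + y \<in> I) \<Longrightarrow>
     (\<And>r x. x \<in> I \<Longrightarrow> r * x \<in> I) \<Longrightarrow> \<exists>a. I = range ((*) a)"


section \<open>Heights and partial decomposition bases\<close>

context module
begin

function p_power :: "'a \<Rightarrow> 'b ordinal \<Rightarrow> 'b set" where
  "p_power p \<alpha> =
     (if \<alpha> = 0 then UNIV
      else if \<exists>\<beta>. \<alpha> = osucc \<beta> then scale p ` p_power p (THE \<beta>. \<alpha> = osucc \<beta>)
      else (\<Inter>\<beta>\<in>{..<\<alpha>}. p_power p \<beta>))"
  by pat_completeness auto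
termination
  by (relation "inv_image {(\<alpha>, \<beta>). \<alpha> < \<beta>} snd") (auto intro: wf)

declare p_power.simps [simp del]

lemma p_power_zero: "p_power p 0 = UNIV"
  by (subst p_power.simps) simp

lemma p_power_osucc: "p_power p (osucc \<beta>) = scale p ` p_power p \<beta>"
  by (subst p_power.simps) auto

lemma p_power_limit:
  "\<alpha> \<noteq> 0 \<Longrightarrow> \<nexists>\<beta>. \<alpha> = osucc \<beta> \<Longrightarrow> p_power p \<alpha> = (\<Inter>\<beta>\<in>{..<\<alpha>}. p_power p \<beta>)"
  by (subst p_power.simps) auto

definition height :: "'a \<Rightarrow> 'b \<Rightarrow> 'b ordinal extended" where
  "height p x =
     (if \<exists>\<alpha>. x \<in> p_power p \<alpha> - p_power p (osucc \<alpha>)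
      then Fin (THE \<alpha>. x \<in> p_power p \<alpha> - p_power p (osucc \<alpha>)) else Pinf)"

definition infinite_order :: "'b \<Rightarrow> bool" where
  "infinite_order x \<longleftrightarrow> (\<forall>a. scale a x = 0 \<longrightarrow> a = 0)"

text \<open>The elements \<open>x\<^sub>1, \<dots>, x\<^sub>n\<close> of \<open>X\<close> are distinct; they are given as the finite set \<open>F\<close>.\<close>

definition decomposition_set :: "'b set \<Rightarrow> bool" where
  "decomposition_set X \<longleftrightarrow>
     independent X \<and> (\<forall>x\<in>X. infinite_order x) \<and>
     (\<forall>F a p. finite F \<and> F \<noteq> {} \<and> F \<subseteq> X \<and> prime_elem p \<longrightarrow>
        height p (\<Sum>x\<in>F. scale (a x) x) = Min ((\<lambda>x. height p (scale (a x) x)) ` F))"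

definition pure_closure :: "'b set \<Rightarrow> 'b set" where
  "pure_closure K = {x. \<exists>a. a \<noteq> 0 \<and> scale a x \<in> K}"

definition partial_decomposition_basis :: "'b set set \<Rightarrow> bool" where
  "partial_decomposition_basis C \<longleftrightarrow>
     C \<noteq> {} \<and> (\<forall>X\<in>C. finite X) \<and>
     (\<forall>X\<in>C. decomposition_set X) \<and>
     (\<forall>X\<in>C. \<forall>x. \<exists>Y\<in>C. X \<subseteq> Y \<and> x \<in> pure_closure (span Y))"

lemma p_power_osucc_subset: "p_power p (osucc \<alpha>) \<subseteq> p_power p \<alpha>"
proof (induction \<alpha> rule: less_induct)
  case (less \<alpha>)
  consider "\<alpha> = 0" | \<beta> where "\<alpha> = osucc \<beta>" | "\<alpha> \<noteq> 0" "\<nexists>\<beta>. \<alpha> = osucc \<beta>" by blast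
  then show ?case
  proof cases
    case 1
    then show ?thesis by (simp add: p_power_zero)
  next
    case 2
    then show ?thesis using less[of \<beta>] by (auto simp: p_power_osucc)
  next
    case 3
    show ?thesis
    proof
      fix y assume "y \<in> p_power p (osucc \<alpha>)"
      then obtain x where x: "x \<in> p_power p \<alpha>" "y = scale p x" by (auto simp: p_power_osucc)
      have "y \<in> p_power p \<beta>" if "\<beta> < \<alpha>" for \<beta>
        using that x less[OF that] 3 by (auto simp: p_power_limit p_power_osucc)
      then show "y \<in> p_power p \<alpha>" using 3 by (simp add: p_power_limit)
    qed
  qed
qed

lemma p_power_antimono: "\<alpha> \<le> \<beta> \<Longrightarrow> p_power p \<beta> \<subseteq> p_power p \<alpha>"
proof (induction \<beta> rule: less_induct)
  case (less \<beta>)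
  consider "\<beta> = 0" | \<gamma> where "\<beta> = osucc \<gamma>" | "\<beta> \<noteq> 0" "\<nexists>\<gamma>. \<beta> = osucc \<gamma>" by blast
  then show ?case
  proof cases
    case 1
    then show ?thesis using less.prems by (metis order_antisym ordinal_zero_le subset_refl)
  next
    case 2
    show ?thesis
    proof (cases "\<alpha> = \<beta>")
      case False
      then have "\<alpha> \<le> \<gamma>" using less.prems 2
        by (metis linorder_le_less_linear order_antisym osucc_le)
      then show ?thesis using less.IH[of \<gamma>] 2 p_power_osucc_subset[of p \<gamma>] by auto
    qed simp
  next
    case 3
    then show ?thesis using less.prems by (cases "\<alpha> = \<beta>") (auto simp: p_power_limit)
  qed
qed

lemma height_unique:
  assumes "x \<in> p_power p \<alpha> - p_power p (osucc \<alpha>)"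
  shows "height p x = Fin \<alpha>"
proof -
  have "\<beta> = \<alpha>" if "x \<in> p_power p \<beta> - p_power p (osucc \<beta>)" for \<beta>
  proof (rule ccontr)
    assume "\<beta> \<noteq> \<alpha>"
    then consider "osucc \<beta> \<le> \<alpha>" | "osucc \<alpha> \<le> \<beta>" by (metis linorder_neqE osucc_le)
    then show False
      using that assms p_power_antimono[of "osucc \<beta>" \<alpha> p] p_power_antimono[of "osucc \<alpha>" \<beta> p]
      by cases auto
  qed
  then have "(THE \<alpha>. x \<in> p_power p \<alpha> - p_power p (osucc \<alpha>)) = \<alpha>"
    using assms by (intro the_equality) blast+
  then show ?thesis
    using assms unfolding height_def by auto
qed

lemma p_power_stationary: "\<exists>\<alpha>. \<forall>\<beta>\<ge>\<alpha>. p_power p \<beta> = p_power p \<alpha>"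
proof -
  let ?r = "cardSuc (card_of (UNIV :: ('b + nat) set))"
  have "\<exists>\<alpha>. p_power p (osucc \<alpha>) = p_power p \<alpha>"
  proof (rule ccontr)
    assume "\<nexists>\<alpha>. p_power p (osucc \<alpha>) = p_power p \<alpha>"
    then have "\<forall>\<alpha>. \<exists>x. x \<in> p_power p \<alpha> - p_power p (osucc \<alpha>)"
      using p_power_osucc_subset by blast
    then obtain f where f: "\<And>\<alpha>. f \<alpha> \<in> p_power p \<alpha> - p_power p (osucc \<alpha>)" by metis
    have "inj f"
      by (rule injI) (metis f height_unique extended.inject)
    then have "inj (\<lambda>\<alpha>. Inl (f \<alpha>) :: 'b + nat)"
      by (simp add: inj_def)
    then have "inj_on (\<lambda>x. Inl (f (Abs_ordinal x)) :: 'b + nat) (Field ?r)"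
      by (intro inj_onI) (metis Abs_ordinal_inject injD)
    then have "ordLeq3 (card_of (Field ?r)) (card_of (UNIV :: ('b + nat) set))"
      by (rule card_of_ordLeqI) simp
    then have "ordLeq3 ?r (card_of (UNIV :: ('b + nat) set))"
      using card_of_Field_ordIso[OF cardSuc_Card_order[OF card_of_Card_order]]
      by (meson ordIso_ordLeq_trans ordIso_symmetric)
    then show False
      using cardSuc_greater[OF card_of_Card_order] not_ordLess_ordLeq by blast
  qed
  then obtain \<alpha> where \<alpha>: "p_power p (osucc \<alpha>) = p_power p \<alpha>" by blast
  have "\<alpha> \<le> \<beta> \<Longrightarrow> p_power p \<alpha> \<subseteq> p_power p \<beta>" for \<beta>
  proof (induction \<beta> rule: less_induct)
    case (less \<beta>)
    consider "\<beta> = \<alpha>" | \<gamma> where "\<beta> \<noteq> \<alpha>" "\<beta> = osucc \<gamma>"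
      | "\<beta> \<noteq> \<alpha>" "\<beta> \<noteq> 0" "\<nexists>\<gamma>. \<beta> = osucc \<gamma>"
      using less.prems by (metis order_antisym ordinal_zero_le)
    then show ?case
    proof cases
      case 2
      then have "\<alpha> \<le> \<gamma>" using less.prems
        by (metis linorder_le_less_linear order_antisym osucc_le)
      then have "p_power p \<alpha> \<subseteq> p_power p \<gamma>" using less.IH 2 by simp
      then show ?thesis using 2 \<alpha> by (metis image_mono p_power_osucc)
    next
      case 3
      have "p_power p \<alpha> \<subseteq> p_power p \<gamma>" if "\<gamma> < \<beta>" for \<gamma>
        using less.IH[OF that] p_power_antimono[of \<gamma> \<alpha> p] by (cases "\<alpha> \<le> \<gamma>") auto
      then show ?thesis using 3 by (auto simp: p_power_limit)
    qed simp
  qed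
  then show ?thesis using p_power_antimono by blast
qed

end

end

theory Submission
  imports Defs
begin

text \<open>
  A back-and-forth argument: the members of a partial decomposition basis are finite, so the
  current sets in \<open>C\<close> and \<open>C'\<close> can be enlarged, each within its own basis, until the pure closure
  of either new span contains the old set of the other side. After \<open>\<omega>\<close> steps each union lies in
  the pure closure of the span of the other, and the property of being a decomposition set
  passes to unions of chains because it has finite character.
\<close>

context module
begin

text \<open>Every condition is tested on finitely many elements at a time, and finitely many
  elements of the union of a nonempty chain already lie together in one member.\<close>

lemma decomposition_set_Union_chain:
  assumes chain: "\<And>X Y. X \<in> \<X> \<Longrightarrow> Y \<in> \<X> \<Longrightarrow> X \<subseteq> Y \<or> Y \<subseteq> X"
    and dec: "\<And>X. X \<in> \<X> \<Longrightarrow> decomposition_set X"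
    and "\<X> \<noteq> {}"
  shows "decomposition_set (\<Union>\<X>)"
  unfolding decomposition_set_def
proof (intro conjI allI impI)
  show "independent (\<Union>\<X>)"
    using chain dec by (intro independent_Union_directed) (auto simp: decomposition_set_def)
  show "\<forall>x\<in>\<Union>\<X>. infinite_order x"
    using dec by (auto simp: decomposition_set_def)
next
  fix F and a :: "'b \<Rightarrow> 'a" and p :: 'a
  assume F: "finite F \<and> F \<noteq> {} \<and> F \<subseteq> \<Union>\<X> \<and> prime_elem p"
  then obtain X where "X \<in> \<X>" "F \<subseteq> X"
    using finite_subset_Union_chain[of F \<X> UNIV] chain \<open>\<X> \<noteq> {}\<close>
    by (auto simp: subset_chain_def)
  then show "height p (\<Sum>x\<in>F. scale (a x) x) = Min ((\<lambda>x. height p (scale (a x) x)) ` F)"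
    using dec F by (simp add: decomposition_set_def)
qed

lemma pure_closure_mono: "K \<subseteq> L \<Longrightarrow> pure_closure K \<subseteq> pure_closure L"
  by (auto simp: pure_closure_def)

text \<open>The extension axiom absorbs one element of \<open>F\<close> at a time; elements absorbed
  earlier stay covered because the pure closure of the span grows with the set.\<close>

lemma partial_decomposition_basis_cover:
  assumes C: "partial_decomposition_basis C" and "X \<in> C" and "finite F"
  shows "\<exists>Y\<in>C. X \<subseteq> Y \<and> F \<subseteq> pure_closure (span Y)"
  using \<open>finite F\<close>
proof (induction F)
  case empty
  then show ?case using \<open>X \<in> C\<close> by auto
next
  case (insert x F)
  then obtain Y where Y: "Y \<in> C" "X \<subseteq> Y" "F \<subseteq> pure_closure (span Y)" by blast
  obtain Z where Z: "Z \<in> C" "Y \<subseteq> Z" "x \<in> pure_closure (span Z)"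
    using C Y(1) unfolding partial_decomposition_basis_def by blast
  show ?case
    using Y Z pure_closure_mono[OF span_mono[OF Z(2)]] by blast
qed

end

text \<open>Over a domain, the pure closure of a span is a submodule, and taking pure closures is
  idempotent: both need products of nonzero scalars to be nonzero. The scalars in the locale
  \<open>module\<close> form only a commutative ring, hence the statement outside it with
  \<open>idom\<close>.\<close>

lemma pure_closure_span_subset:
  fixes scale :: "'r::idom \<Rightarrow> 'g::ab_group_add \<Rightarrow> 'g"
  assumes "module scale"
    and sub: "A \<subseteq> module.pure_closure scale (module.span scale B)"
  shows "module.pure_closure scale (module.span scale A) \<subseteq>
    module.pure_closure scale (module.span scale B)"
proof -
  interpret module scale by fact
  have "span A \<subseteq> pure_closure (span B)"
  proof (rule span_minimal[OF sub], rule subspaceI)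
    show "0 \<in> pure_closure (span B)"
      unfolding pure_closure_def using span_zero by (auto intro!: exI[of _ 1])
  next
    fix x y assume "x \<in> pure_closure (span B)" "y \<in> pure_closure (span B)"
    then obtain a b where "a \<noteq> 0" "b \<noteq> 0" and ab: "scale a x \<in> span B" "scale b y \<in> span B"
      by (auto simp: pure_closure_def)
    \<comment> \<open>The product \<open>a * b\<close> serves as a common denominator for
      \<open>x\<close> and \<open>y\<close>.\<close>
    moreover have "scale (a * b) (x + y) = scale b (scale a x) + scale a (scale b y)"
      by (simp add: scale_right_distrib mult.commute)
    then have "scale (a * b) (x + y) \<in> span B"
      using ab by (simp add: span_add span_scale del: scale_scale)
    ultimately show "x + y \<in> pure_closure (span B)"
      by (auto simp: pure_closure_def intro!: exI[of _ "a * b"])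
  next
    fix c x assume "x \<in> pure_closure (span B)"
    then obtain a where "a \<noteq> 0" "scale a x \<in> span B"
      by (auto simp: pure_closure_def)
    then show "scale c x \<in> pure_closure (span B)"
      using span_scale[of "scale a x" B c]
      by (auto simp: pure_closure_def mult.commute intro!: exI[of _ a])
  qed
  show ?thesis
  proof
    fix x assume "x \<in> pure_closure (span A)"
    then obtain a where a: "a \<noteq> 0" "scale a x \<in> pure_closure (span B)"
      using \<open>span A \<subseteq> _\<close> unfolding pure_closure_def[of "span A"] by blast
    then obtain b where "b \<noteq> 0" "scale b (scale a x) \<in> span B"
      unfolding pure_closure_def by blast
    then have "b * a \<noteq> 0" "scale (b * a) x \<in> span B"
      using a(1) by simp_all
    then show "x \<in> pure_closure (span B)" unfolding pure_closure_def by blast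
  qed
qed

theorem theorem6:
  fixes scale :: "'r::principal_ideal_domain \<Rightarrow> 'g::ab_group_add \<Rightarrow> 'g"
    and C C' :: "'g set set" and X Y :: "'g set"
  assumes "module scale"
    and "module.partial_decomposition_basis scale C"
    and "module.partial_decomposition_basis scale C'"
    and "X \<in> C" and "Y \<in> C'"
  shows "\<exists>X' Y'.
    module.decomposition_set scale X' \<and> module.decomposition_set scale Y' \<and>
    X \<subseteq> X' \<and> Y \<subseteq> Y' \<and>
    (\<exists>S :: nat \<Rightarrow> 'g set. mono S \<and> range S \<subseteq> C \<and> X' = (\<Union>n. S n)) \<and>
    (\<exists>T :: nat \<Rightarrow> 'g set. mono T \<and> range T \<subseteq> C' \<and> Y' = (\<Union>n. T n)) \<and>
    module.pure_closure scale (module.span scale X') =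
      module.pure_closure scale (module.span scale Y')"
proof -
  interpret module scale by fact
  have finite: "finite A" if "A \<in> C \<or> A \<in> C'" for A
    using that assms(2,3) by (auto simp: partial_decomposition_basis_def)
  have dec: "decomposition_set A" if "A \<in> C \<or> A \<in> C'" for A
    using that assms(2,3) by (auto simp: partial_decomposition_basis_def)
  \<comment> \<open>The containments of \<open>X\<close> and \<open>Y\<close> are part of the
    invariant because dependent choice below yields some good initial pair, not necessarily
    \<open>(X, Y)\<close> itself.\<close>
  define good where "good P \<longleftrightarrow> fst P \<in> C \<and> snd P \<in> C' \<and> X \<subseteq> fst P \<and> Y \<subseteq> snd P"
    for P :: "'g set \<times> 'g set"
  \<comment> \<open>Each new set has to capture only the old set of the other side, so both can be
    enlarged independently in the same step.\<close>
  define step where "step P Q \<longleftrightarrow> fst P \<subseteq> fst Q \<and> snd P \<subseteq> snd Q \<and>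
      fst P \<subseteq> pure_closure (span (snd Q)) \<and> snd P \<subseteq> pure_closure (span (fst Q))"
    for P Q :: "'g set \<times> 'g set"
  have "\<exists>Q. good Q \<and> step P Q" if "good P" for P
  proof -
    have P: "fst P \<in> C" "snd P \<in> C'" using that by (auto simp: good_def)
    \<comment> \<open>The covering lemma applies to \<open>snd P\<close> and \<open>fst P\<close>
      because members of both bases are finite.\<close>
    obtain A B where "A \<in> C" "fst P \<subseteq> A" "snd P \<subseteq> pure_closure (span A)"
      and "B \<in> C'" "snd P \<subseteq> B" "fst P \<subseteq> pure_closure (span B)"
      using P finite partial_decomposition_basis_cover[OF assms(2) P(1), of "snd P"]
        partial_decomposition_basis_cover[OF assms(3) P(2), of "fst P"] by blast
    then show ?thesis
      using that by (intro exI[of _ "(A, B)"]) (auto simp: good_def step_def)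
  qed
  moreover have "good (X, Y)" using assms by (simp add: good_def)
  ultimately obtain P where P: "\<And>n. good (P n)" "\<And>n. step (P n) (P (Suc n))"
    using dependent_nat_choice[of "\<lambda>_. good" "\<lambda>_. step"] by blast
  define S T where "S n = fst (P n)" and "T n = snd (P n)" for n :: nat
  define X' Y' where "X' = (\<Union>n. S n)" and "Y' = (\<Union>n. T n)"
  have mono: "mono S" "mono T"
    using P(2) by (auto simp: mono_iff_le_Suc S_def T_def step_def)
  have range: "range S \<subseteq> C" "range T \<subseteq> C'"
    using P(1) by (auto simp: good_def S_def T_def)
  have union: "decomposition_set (\<Union>n. U n)"
    if "mono U" "\<And>n. U n \<in> C \<or> U n \<in> C'" for U :: "nat \<Rightarrow> 'g set"
    using that dec by (intro decomposition_set_Union_chain) (auto, metis monoD nat_le_linear subsetD)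
  have "decomposition_set X'" "decomposition_set Y'"
    unfolding X'_def Y'_def using mono range by (auto intro!: union)
  moreover have "X \<subseteq> X'" "Y \<subseteq> Y'"
    using P(1) by (auto simp: good_def X'_def Y'_def S_def T_def)
  moreover have "X' \<subseteq> pure_closure (span Y')" "Y' \<subseteq> pure_closure (span X')"
  proof -
    \<comment> \<open>What enters on one side at stage \<open>n\<close> is captured by the other
      side at stage \<open>Suc n\<close>, hence by its union.\<close>
    have "S n \<subseteq> pure_closure (span Y')" for n
      using P(2)[of n] pure_closure_mono[OF span_mono, of "T (Suc n)" Y']
      unfolding step_def S_def T_def Y'_def by blast
    then show "X' \<subseteq> pure_closure (span Y')" by (auto simp: X'_def)
    have "T n \<subseteq> pure_closure (span X')" for n
      using P(2)[of n] pure_closure_mono[OF span_mono, of "S (Suc n)" X']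
      unfolding step_def S_def T_def X'_def by blast
    then show "Y' \<subseteq> pure_closure (span X')" by (auto simp: Y'_def)
  qed
  then have "pure_closure (span X') = pure_closure (span Y')"
    by (intro equalityI pure_closure_span_subset[OF assms(1)])
  ultimately show ?thesis
    using mono range X'_def Y'_def by blast
qed

end
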